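(* Let $d\geq 1$ and $k\geq 2$ be integers, and let $X$ be a set of $k(d+1)$ points in $\mathbb{R}^d$ in general position with respect to the origin $0$. Let $B_0(X)$ denote the number of unordered Birch partitions of $X$ for the origin. Then the following properties hold: (i) $B_0(X)$ is even. (ii) If $B_0(X)>0$, then $B_0(X)\geq k!$.
   Context: A set of points in $\mathbb{R}^d$ is in general position if, for every integer $j$ with $0\le j\le d-1$, no $j+2$ of its points lie on a common $j$-dimensional affine subspace. A set $X\subset\mathbb{R}^d$ is in general position with respect to a point $p$ if $X\cup\{p\}$ is in general position, where $p\notin X$. For a set $X$ of $k(d+1)$ points in $\mathbb{R}^d$, a Birch partition of $X$ for the origin is a partition of $X$ into $k$ subsets, each of size $d+1$, such that the convex hull of each of these subsets contains the origin $0$. Partitions are unordered (the order of the blocks does not matter), and $B_0(X)$ is the number of such partitions. *)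

theory Defs
  imports "HOL-Analysis.Analysis" "HOL-Library.Disjoint_Sets"
begin

definition general_position :: "'a::euclidean_space set \<Rightarrow> bool" where
  "general_position X \<longleftrightarrow>
     (\<forall>j<DIM('a). \<forall>T. T \<subseteq> X \<and> card T = j + 2 \<longrightarrow>
        \<not> (\<exists>A. affine A \<and> aff_dim A = int j \<and> T \<subseteq> A))"

definition general_position_wrt :: "'a::euclidean_space set \<Rightarrow> 'a \<Rightarrow> bool" where
  "general_position_wrt X p \<longleftrightarrow> p \<notin> X \<and> general_position (insert p X)"

definition birch_partition :: "nat \<Rightarrow> 'a::euclidean_space set \<Rightarrow> 'a set set \<Rightarrow> bool" where
  "birch_partition k X P \<longleftrightarrow>
     partition_on X P \<and> card P = k \<and>
     (\<forall>B\<in>P. card B = DIM('a) + 1 \<and> 0 \<in> convex hull B)"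

(* B_0(X).  Partitions are sets of blocks, hence unordered.  For finite X the set counted
   here is finite, so card is the true number of Birch partitions. *)
definition birch_count :: "nat \<Rightarrow> 'a::euclidean_space set \<Rightarrow> nat" where
  "birch_count k X = card {P. birch_partition k X P}"

end

theory Submission
  imports Defs "HOL-Library.Z2"
begin

text \<open>
  Write \<open>f B\<close> for ``\<open>0\<close> lies in the convex hull of \<open>B\<close>'', where \<open>B\<close> ranges over sets of
  \<open>m = d + 1\<close> points. The only geometric input is that \<open>f\<close> is a cocycle modulo 2: among the
  \<open>d + 2\<close> sets obtained from \<open>d + 2\<close> points by deleting one of them, an even number capture the
  origin (lemma \<open>mod2_cocycle_zero_in_convex_hull\<close>). In fact this number is 0 or 2, because the
  nonnegative linear relations with coefficient sum 1 among \<open>d + 2\<close> vectors in general position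
  form a segment or the empty set, and the ends of the segment are the captures. Everything after
  that is combinatorics of an arbitrary such \<open>f\<close>.

  For two blocks, fix a point \<open>x\<close> and let \<open>A\<close> be the block that contains it. Applying the cocycle
  condition to the complement of \<open>A\<close> together with \<open>x\<close> rewrites \<open>f (X - A)\<close> modulo 2 as the sum
  of \<open>f (insert x (X - A - {a}))\<close> over \<open>a\<close> outside \<open>A\<close>. So the number of partitions is congruent
  to the number of ways to split the points other than \<open>x\<close> into an ordered pair of \<open>d\<close>-sets
  \<open>S\<close>, \<open>T\<close> and one leftover point \<open>a\<close> such that both \<open>insert x S\<close> and \<open>insert x T\<close> satisfy
  \<open>f\<close>. Exchanging \<open>S\<close> and \<open>T\<close> shows that this number is even
  (\<open>even_card_complementary_blocks\<close>). For more blocks, sum over the block that contains \<open>x\<close> and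
  use induction.

  The lower bound uses only the parity statement for two blocks. Given a partition into \<open>k\<close> blocks,
  let \<open>F\<close> be the block of \<open>x\<close>. For each of the other \<open>k - 1\<close> blocks \<open>G\<close>, the number of ways to split
  \<open>F \<union> G\<close> is even and positive, so there is a second way, and it gives a new block at \<open>x\<close> which
  meets \<open>G\<close> and no other block besides \<open>F\<close>. Together with \<open>F\<close> these are \<open>k\<close> distinct blocks
  at \<open>x\<close>, each of which extends to a partition (\<open>card_extendable_blocks_at_ge\<close>). By induction each
  extends in at least \<open>(k - 1)!\<close> ways, which gives \<open>k!\<close> partitions.
\<close>

section \<open>Facets of d + 2 vectors that capture the origin\<close>

text \<open>
  If \<open>d\<close> points were linearly dependent, then some hyperplane through the origin would contain
  them; with the origin, that makes \<open>d + 1\<close> points in an affine subspace of dimension \<open>d - 1\<close>.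
\<close>

lemma general_position_wrt_0_imp_independent:
  fixes X :: "'a::euclidean_space set"
  assumes gp: "general_position_wrt X 0" and D: "D \<subseteq> X" "card D = DIM('a)"
  shows "independent D"
proof
  assume dep: "dependent D"
  have fin: "finite D"
    using D(2) by (intro card_ge_0_finite) simp
  (* General position speaks of affine subspaces of dimension exactly d - 1, so the possibly smaller span
     of D is enlarged to a hyperplane. *)
  have "dim D \<le> card D"
    using fin by (rule dim_le_card')
  moreover have "dim D \<noteq> card D"
    using dep fin card_le_dim_spanning[of D D] span_superset[of D] by auto
  ultimately have "dim D < DIM('a)"
    using D(2) by simp
  then obtain a :: 'a where a: "a \<noteq> 0" "span D \<subseteq> {x. a \<bullet> x = 0}"
    using lowdim_subset_hyperplane by blast
  let ?H = "{x. a \<bullet> x = 0}"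
  have "0 \<notin> D" using gp D by (auto simp: general_position_wrt_def)
  then have "card (insert 0 D) = (DIM('a) - 1) + 2"
    using fin D(2) DIM_positive[where 'a='a] by simp
  moreover have "insert 0 D \<subseteq> insert 0 X" "insert 0 D \<subseteq> ?H"
    using D(1) a(2) span_superset[of D] by auto
  moreover have "affine ?H" "aff_dim ?H = int (DIM('a) - 1)"
    using a(1) affine_hyperplane by (auto simp: of_nat_diff Suc_leI)
  moreover have "DIM('a) - 1 < DIM('a)" by simp
  ultimately show False
    using gp unfolding general_position_wrt_def general_position_def by blast
qed

text \<open>
  Two zero coefficients leave a relation between \<open>d\<close> independent vectors. This is the form in which
  general position is used for the relations among \<open>d + 2\<close> vectors.
\<close>

lemma relation_with_two_zeros_vanishes:
  fixes Y :: "'a::euclidean_space set"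
  assumes ind: "\<And>D. D \<subseteq> Y \<Longrightarrow> card D = DIM('a) \<Longrightarrow> independent D"
    and Y: "card Y = DIM('a) + 2"
    and rel: "(\<Sum>v\<in>Y. u v *\<^sub>R v) = 0"
    and zeros: "y \<in> Y" "z \<in> Y" "y \<noteq> z" "u y = 0" "u z = 0"
    and w: "w \<in> Y"
  shows "u w = 0"
proof (cases "w = y \<or> w = z")
  case False
  have fin: "finite Y" using Y by (intro card_ge_0_finite) simp
  have "(\<Sum>v\<in>Y - {y, z}. u v *\<^sub>R v) = (\<Sum>v\<in>Y. u v *\<^sub>R v)"
    using fin zeros by (intro sum.mono_neutral_left) auto
  then have "(\<Sum>v\<in>Y - {y, z}. u v *\<^sub>R v) = 0" using rel by simp
  moreover have "card (Y - {y, z}) = DIM('a)"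
    using Y zeros fin by (simp add: card_Diff_subset)
  then have "independent (Y - {y, z})" by (intro ind) auto
  ultimately show ?thesis
    using independentD[of "Y - {y, z}" "Y - {y, z}" u w] fin w False by auto
qed (use zeros in auto)

text \<open>
  A convex combination giving the origin is a relation that already has the coefficient 0 at \<open>y\<close>.
  If a second coefficient vanished, all would, although they add up to 1.
\<close>

lemma zero_in_facet_hull_imp_positive_relation:
  fixes Y :: "'a::euclidean_space set"
  assumes ind: "\<And>D. D \<subseteq> Y \<Longrightarrow> card D = DIM('a) \<Longrightarrow> independent D"
    and Y: "card Y = DIM('a) + 2" and y: "y \<in> Y"
    and hull: "0 \<in> convex hull (Y - {y})"
  obtains \<alpha> where "\<alpha> y = 0" "\<And>v. v \<in> Y - {y} \<Longrightarrow> \<alpha> v > 0" "(\<Sum>v\<in>Y. \<alpha> v *\<^sub>R v) = 0"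
proof -
  have fin: "finite Y" using Y by (intro card_ge_0_finite) simp
  obtain u where u: "\<forall>v\<in>Y - {y}. 0 \<le> u v" "sum u (Y - {y}) = 1"
      "(\<Sum>v\<in>Y - {y}. u v *\<^sub>R v) = 0"
    using hull fin by (auto simp: convex_hull_finite)
  define \<alpha> where "\<alpha> = u(y := 0)"
  have "sum \<alpha> (Y - {y}) = sum u (Y - {y})"
      "(\<Sum>v\<in>Y - {y}. \<alpha> v *\<^sub>R v) = (\<Sum>v\<in>Y - {y}. u v *\<^sub>R v)"
    by (intro sum.cong; simp add: \<alpha>_def)+
  then have sums: "sum \<alpha> (Y - {y}) = 1" "(\<Sum>v\<in>Y - {y}. \<alpha> v *\<^sub>R v) = 0"
    using u(2,3) by auto
  have rel: "(\<Sum>v\<in>Y. \<alpha> v *\<^sub>R v) = 0"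
    using sums(2) fin y by (simp add: sum.remove \<alpha>_def)
  have "\<alpha> v > 0" if v: "v \<in> Y - {y}" for v
  proof (rule ccontr)
    assume "\<not> \<alpha> v > 0"
    then have "\<alpha> v = 0" using u(1) v by (auto simp: \<alpha>_def not_less order_antisym)
    then have "\<alpha> w = 0" if "w \<in> Y" for w
      using relation_with_two_zeros_vanishes[OF ind Y rel y, of v w] v that
      by (auto simp: \<alpha>_def)
    then show False using sums(1) by simp
  qed
  then show thesis using rel by (intro that[of \<alpha>]) (auto simp: \<alpha>_def)
qed

text \<open>
  Starting from the relation \<open>\<alpha>\<close> that is 0 at \<open>y\<close> and positive elsewhere, one walks along the segment
  of nonnegative relations to its other end: add to \<open>\<alpha>\<close> a growing multiple of a relation \<open>\<mu>\<close> with
  \<open>\<mu> y = 1\<close> until some other coefficient reaches 0. Below, the scaling is \<open>\<mu> + t \<alpha>\<close> with the smallest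
  possible \<open>t\<close>.
\<close>

lemma zero_in_second_facet_hull:
  fixes Y :: "'a::euclidean_space set"
  assumes ind: "\<And>D. D \<subseteq> Y \<Longrightarrow> card D = DIM('a) \<Longrightarrow> independent D"
    and Y: "card Y = DIM('a) + 2" and y: "y \<in> Y"
    and hull: "0 \<in> convex hull (Y - {y})"
  obtains z where "z \<in> Y" "z \<noteq> y" "0 \<in> convex hull (Y - {z})"
proof -
  have fin: "finite Y" using Y by (intro card_ge_0_finite) simp
  obtain \<alpha> where \<alpha>: "\<alpha> y = 0" "\<And>v. v \<in> Y - {y} \<Longrightarrow> \<alpha> v > 0" "(\<Sum>v\<in>Y. \<alpha> v *\<^sub>R v) = 0"
    using zero_in_facet_hull_imp_positive_relation[OF ind Y y hull] by blast
  have card1: "card (Y - {y}) = DIM('a) + 1" using Y y fin by simp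
  then obtain D where D: "D \<subseteq> Y - {y}" "card D = DIM('a)"
    by (metis le_add1 obtain_subset_with_card_n)
  have "independent D" using D by (intro ind) auto
  then have "y \<in> span D"
    using card_ge_dim_independent[of D UNIV] D(2) by auto
  moreover have finD: "finite D" using D(1) fin finite_subset by blast
  ultimately obtain c where c: "y = (\<Sum>v\<in>D. c v *\<^sub>R v)"
    by (auto simp: span_finite)
  (* The relation that expresses y in the basis D. *)
  define \<mu> where "\<mu> v = (if v = y then 1 else if v \<in> D then - c v else 0)" for v
  have "(\<Sum>v\<in>Y. \<mu> v *\<^sub>R v) = y + (\<Sum>v\<in>Y - {y}. \<mu> v *\<^sub>R v)"
    using fin y by (simp add: sum.remove \<mu>_def)
  also have "(\<Sum>v\<in>Y - {y}. \<mu> v *\<^sub>R v) = (\<Sum>v\<in>D. \<mu> v *\<^sub>R v)"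
    using fin D(1) by (intro sum.mono_neutral_right) (auto simp: \<mu>_def)
  also have "\<dots> = (\<Sum>v\<in>D. - (c v *\<^sub>R v))"
    using D(1) by (intro sum.cong) (auto simp: \<mu>_def)
  also have "\<dots> = - y" using c by (simp add: sum_negf)
  finally have \<mu>: "(\<Sum>v\<in>Y. \<mu> v *\<^sub>R v) = 0" by simp
  (* The least t for which every coefficient of \<mu> + t \<alpha> is nonnegative; it is attained at z. *)
  define t where "t = Max ((\<lambda>v. - \<mu> v / \<alpha> v) ` (Y - {y}))"
  have ne: "Y - {y} \<noteq> {}" using card1 by force
  have "t \<in> (\<lambda>v. - \<mu> v / \<alpha> v) ` (Y - {y})"
    unfolding t_def using fin ne by (intro Max_in) auto
  then obtain z where z: "z \<in> Y - {y}" "t = - \<mu> z / \<alpha> z" by blast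
  define \<beta> where "\<beta> v = \<mu> v + t * \<alpha> v" for v
  have nonneg: "\<beta> v \<ge> 0" if "v \<in> Y" for v
  proof (cases "v = y")
    case False
    then have "- \<mu> v / \<alpha> v \<le> t" unfolding t_def using fin that by (intro Max_ge) auto
    then show ?thesis using \<alpha>(2)[of v] that False by (simp add: \<beta>_def field_simps)
  qed (simp add: \<beta>_def \<mu>_def \<alpha>(1))
  have \<beta>z: "\<beta> z = 0" using z \<alpha>(2)[of z] by (simp add: \<beta>_def)
  have \<beta>y: "\<beta> y = 1" by (simp add: \<beta>_def \<mu>_def \<alpha>(1))
  have "(\<Sum>v\<in>Y. \<beta> v *\<^sub>R v) = (\<Sum>v\<in>Y. \<mu> v *\<^sub>R v) + t *\<^sub>R (\<Sum>v\<in>Y. \<alpha> v *\<^sub>R v)"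
    by (simp add: \<beta>_def scaleR_left_distrib sum.distrib scaleR_sum_right)
  then have rel: "(\<Sum>v\<in>Y - {z}. \<beta> v *\<^sub>R v) = 0"
    using \<mu> \<alpha>(3) \<beta>z z(1) fin by (simp add: sum.remove[of Y z])
  define s where "s = sum \<beta> (Y - {z})"
  have "\<beta> y \<le> s"
    unfolding s_def using fin y z(1) nonneg by (intro member_le_sum) auto
  then have s: "s > 0" using \<beta>y by simp
  have "0 \<in> convex hull (Y - {z})"
    unfolding convex_hull_finite[OF finite_Diff[OF fin]] mem_Collect_eq
  proof (intro exI conjI ballI)
    show "0 \<le> \<beta> v / s" if "v \<in> Y - {z}" for v
      using nonneg[of v] that s by simp
    show "(\<Sum>v\<in>Y - {z}. \<beta> v / s) = 1"
      using s by (simp add: sum_divide_distrib[symmetric] s_def)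
    have "(\<Sum>v\<in>Y - {z}. (\<beta> v / s) *\<^sub>R v) = inverse s *\<^sub>R (\<Sum>v\<in>Y - {z}. \<beta> v *\<^sub>R v)"
      by (simp add: scaleR_sum_right divide_inverse mult.commute)
    then show "(\<Sum>v\<in>Y - {z}. (\<beta> v / s) *\<^sub>R v) = 0" using rel by simp
  qed
  then show thesis using z(1) by (intro that) auto
qed

text \<open>
  The relations form a space of dimension 2, so three nonnegative ones vanishing at \<open>y\<close>, \<open>z\<close> and
  \<open>w\<close> respectively would be three extreme rays of a planar cone. Concretely, subtracting from the
  third a positive combination of the first two kills the coefficients at \<open>y\<close> and \<open>z\<close>, hence all
  of them, but leaves a negative coefficient at \<open>w\<close>.
\<close>

lemma zero_in_at_most_two_facet_hulls:
  fixes Y :: "'a::euclidean_space set"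
  assumes ind: "\<And>D. D \<subseteq> Y \<Longrightarrow> card D = DIM('a) \<Longrightarrow> independent D"
    and Y: "card Y = DIM('a) + 2"
    and yz: "y \<in> Y" "z \<in> Y" "w \<in> Y" "y \<noteq> z" "y \<noteq> w" "z \<noteq> w"
    and hull: "0 \<in> convex hull (Y - {y})" "0 \<in> convex hull (Y - {z})"
  shows "0 \<notin> convex hull (Y - {w})"
proof
  assume hw: "0 \<in> convex hull (Y - {w})"
  obtain \<alpha> where \<alpha>: "\<alpha> y = 0" "\<And>v. v \<in> Y - {y} \<Longrightarrow> \<alpha> v > 0" "(\<Sum>v\<in>Y. \<alpha> v *\<^sub>R v) = 0"
    using zero_in_facet_hull_imp_positive_relation[OF ind Y yz(1) hull(1)] by blast
  obtain \<beta> where \<beta>: "\<beta> z = 0" "\<And>v. v \<in> Y - {z} \<Longrightarrow> \<beta> v > 0" "(\<Sum>v\<in>Y. \<beta> v *\<^sub>R v) = 0"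
    using zero_in_facet_hull_imp_positive_relation[OF ind Y yz(2) hull(2)] by blast
  obtain \<gamma> where \<gamma>: "\<gamma> w = 0" "\<And>v. v \<in> Y - {w} \<Longrightarrow> \<gamma> v > 0" "(\<Sum>v\<in>Y. \<gamma> v *\<^sub>R v) = 0"
    using zero_in_facet_hull_imp_positive_relation[OF ind Y yz(3) hw] by blast
  define a b where "a = \<gamma> z / \<alpha> z" and "b = \<gamma> y / \<beta> y"
  have pos: "\<alpha> z > 0" "\<alpha> w > 0" "\<beta> y > 0" "\<beta> w > 0" "\<gamma> y > 0" "\<gamma> z > 0"
    using \<alpha>(2) \<beta>(2) \<gamma>(2) yz by auto
  define \<delta> where "\<delta> v = \<gamma> v - a * \<alpha> v - b * \<beta> v" for v
  have "(\<Sum>v\<in>Y. \<delta> v *\<^sub>R v) = (\<Sum>v\<in>Y. \<gamma> v *\<^sub>R v) - a *\<^sub>R (\<Sum>v\<in>Y. \<alpha> v *\<^sub>R v)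
      - b *\<^sub>R (\<Sum>v\<in>Y. \<beta> v *\<^sub>R v)"
    by (simp add: \<delta>_def scaleR_left_diff_distrib sum_subtractf scaleR_sum_right)
  then have rel: "(\<Sum>v\<in>Y. \<delta> v *\<^sub>R v) = 0" using \<alpha>(3) \<beta>(3) \<gamma>(3) by simp
  have "\<delta> y = 0" "\<delta> z = 0"
    using pos \<alpha>(1) \<beta>(1) by (auto simp: \<delta>_def a_def b_def)
  then have "\<delta> w = 0"
    using relation_with_two_zeros_vanishes[OF ind Y rel] yz by blast
  moreover have "a * \<alpha> w > 0" "b * \<beta> w > 0" using pos by (auto simp: a_def b_def)
  ultimately show False using \<gamma>(1) by (simp add: \<delta>_def)
qed

section \<open>Blocks cut out by a cocycle modulo 2\<close>

text \<open>
  Reading \<open>f\<close> as a cochain modulo 2 on the \<open>m\<close>-element faces of the full simplex on \<open>X\<close>, this says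
  that its coboundary vanishes.
\<close>

definition mod2_cocycle :: "nat \<Rightarrow> ('a set \<Rightarrow> bool) \<Rightarrow> 'a set \<Rightarrow> bool" where
  "mod2_cocycle m f X \<longleftrightarrow>
     (\<forall>Y\<subseteq>X. card Y = Suc m \<longrightarrow> even (card {y\<in>Y. f (Y - {y})}))"

lemma mod2_cocycle_subset: "mod2_cocycle m f X \<Longrightarrow> Z \<subseteq> X \<Longrightarrow> mod2_cocycle m f Z"
  unfolding mod2_cocycle_def by blast

lemma mod2_cocycle_zero_in_convex_hull:
  fixes X :: "'a::euclidean_space set"
  assumes "general_position_wrt X 0"
  shows "mod2_cocycle (DIM('a) + 1) (\<lambda>B. 0 \<in> convex hull B) X"
  unfolding mod2_cocycle_def
proof (intro allI impI)
  fix Y assume Y: "Y \<subseteq> X" "card Y = Suc (DIM('a) + 1)"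
  then have ind: "\<And>D. D \<subseteq> Y \<Longrightarrow> card D = DIM('a) \<Longrightarrow> independent D"
    using general_position_wrt_0_imp_independent[OF assms] by blast
  have card: "card Y = DIM('a) + 2" using Y by simp
  let ?E = "{y\<in>Y. 0 \<in> convex hull (Y - {y})}"
  show "even (card ?E)"
  proof (cases "?E = {}")
    case False
    then obtain y where y: "y \<in> Y" "0 \<in> convex hull (Y - {y})" by blast
    obtain z where z: "z \<in> Y" "z \<noteq> y" "0 \<in> convex hull (Y - {z})"
      using zero_in_second_facet_hull[OF ind card y] by blast
    have "?E = {y, z}"
      using y z zero_in_at_most_two_facet_hulls[OF ind card y(1) z(1) _ z(2)[symmetric] _ _ y(2) z(3)]
      by blast
    then show ?thesis using z(2) by simp
  next
    case True
    then show ?thesis by (simp only: card.empty even_zero)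
  qed
qed

definition blocks_at :: "nat \<Rightarrow> ('a set \<Rightarrow> bool) \<Rightarrow> 'a \<Rightarrow> 'a set \<Rightarrow> 'a set set" where
  "blocks_at m f x X = {A. A \<subseteq> X \<and> x \<in> A \<and> card A = m \<and> f A}"

lemma finite_blocks_at: "finite X \<Longrightarrow> finite (blocks_at m f x X)"
  unfolding blocks_at_def by (rule finite_subset[of _ "Pow X"]) auto

text \<open>Pairing \<open>x\<close> with \<open>h x\<close> makes the terms of \<open>\<Sum>x\<in>X. 1\<close> cancel in characteristic 2.\<close>

lemma even_card_fixpoint_free_involution:
  assumes "\<And>x. x \<in> X \<Longrightarrow> h x \<in> X" "\<And>x. x \<in> X \<Longrightarrow> h (h x) = x" "\<And>x. x \<in> X \<Longrightarrow> h x \<noteq> x"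
  shows "even (card X)"
proof -
  have "(\<Sum>x\<in>X. 1::bit) = 0"
    by (rule sum_involution_eq_0[where h = h]) (use assms in auto)
  then have "of_nat (card X) = (0::bit)" by simp
  then show ?thesis
    by (metis even_of_nat even_zero)
qed

text \<open>
  By the cocycle condition on \<open>insert x (X - A)\<close>, the truth value of \<open>f (X - A)\<close> is the parity of
  the number of \<open>a\<close> with \<open>f (insert x (X - A - {a}))\<close>. So the sets \<open>A\<close> to be counted have the same
  parity as the pairs \<open>(A, a)\<close>, and on these pairs replacing \<open>A\<close> by \<open>insert x (X - A - {a})\<close> is an
  involution. A fixed point would force \<open>A = {x}\<close>, which \<open>m \<ge> 2\<close> excludes.
\<close>

lemma even_card_complementary_blocks:
  assumes cocycle: "mod2_cocycle m f X" and X: "card X = 2 * m" and m: "m \<ge> 2" and x: "x \<in> X"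
  shows "even (card {A \<in> blocks_at m f x X. f (X - A)})"
proof -
  have fin: "finite X" using X m by (intro card_ge_0_finite) simp
  let ?\<A> = "blocks_at m f x X"
  let ?swap = "\<lambda>A a. insert x (X - A - {a})"
  let ?T = "\<lambda>A. {a \<in> X - A. f (?swap A a)}"
  have A: "A \<subseteq> X" "x \<in> A" "card A = m" "f A" "finite A" "card (X - A) = m"
    if "A \<in> ?\<A>" for A
    using that fin X finite_subset[of A X] by (auto simp: blocks_at_def card_Diff_subset)
  have parity: "odd (card (?T A)) \<longleftrightarrow> f (X - A)" if "A \<in> ?\<A>" for A
  proof -
    note A = A[OF that]
    let ?Y = "insert x (X - A)"
    have "card ?Y = Suc m" using A fin by simp
    then have "even (card {y\<in>?Y. f (?Y - {y})})"
      using cocycle x unfolding mod2_cocycle_def by (metis Diff_subset insert_subset)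
    moreover have "{y\<in>?Y. f (?Y - {y})} = (if f (X - A) then insert x (?T A) else ?T A)"
    proof (rule set_eqI)
      fix y
      show "y \<in> {y\<in>?Y. f (?Y - {y})} \<longleftrightarrow> y \<in> (if f (X - A) then insert x (?T A) else ?T A)"
      proof (cases "y = x")
        case True
        have "?Y - {x} = X - A" using A by auto
        then show ?thesis using True A(2) by simp
      next
        case False
        then have "?Y - {y} = ?swap A y" by blast
        then show ?thesis using False by simp
      qed
    qed
    moreover have "x \<notin> ?T A" "finite (?T A)" using A fin by auto
    ultimately show ?thesis by (auto split: if_splits)
  qed
  have "even (card (SIGMA A:?\<A>. ?T A))"
  proof (rule even_card_fixpoint_free_involution[where h = "\<lambda>(A, a). (?swap A a, a)"])
    fix p assume "p \<in> (SIGMA A:?\<A>. ?T A)"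
    then obtain B a where p: "p = (B, a)" and B: "B \<in> ?\<A>" and a: "a \<in> X - B" "f (?swap B a)"
      by auto
    note A = A[OF B]
    have swap_swap: "?swap (?swap B a) a = B" using A a x by auto
    have "card (?swap B a) = m"
      using A a fin m by simp
    then have "?swap B a \<in> ?\<A>" using a x by (auto simp: blocks_at_def)
    moreover have "a \<in> X - ?swap B a" using a A by auto
    ultimately show "(case p of (A, a) \<Rightarrow> (?swap A a, a)) \<in> (SIGMA A:?\<A>. ?T A)"
      unfolding p using swap_swap A(4) by simp
    show "(case case p of (A, a) \<Rightarrow> (?swap A a, a) of (A, a) \<Rightarrow> (?swap A a, a)) = p"
      using p swap_swap by simp
    have "?swap B a \<noteq> B"
    proof
      assume "?swap B a = B"
      then have "B = {x}" using A by blast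
      then show False using A(3) m by simp
    qed
    then show "(case p of (A, a) \<Rightarrow> (?swap A a, a)) \<noteq> p" using p by simp
  qed
  also have "card (SIGMA A:?\<A>. ?T A) = (\<Sum>A\<in>?\<A>. card (?T A))"
    using fin finite_blocks_at[OF fin] by simp
  finally have "even (card {A\<in>?\<A>. odd (card (?T A))})"
    using even_sum_iff[OF finite_blocks_at[OF fin], of "\<lambda>A. card (?T A)"] by blast
  also have "{A\<in>?\<A>. odd (card (?T A))} = {A\<in>?\<A>. f (X - A)}"
    using parity by blast
  finally show ?thesis .
qed

section \<open>Counting partitions into such blocks\<close>

text \<open>Birch partitions are the case \<open>m = d + 1\<close> with \<open>f\<close> expressing that \<open>B\<close> captures the origin.\<close>

definition block_partitions ::
    "nat \<Rightarrow> ('a set \<Rightarrow> bool) \<Rightarrow> nat \<Rightarrow> 'a set \<Rightarrow> 'a set set set" where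
  "block_partitions m f k X =
     {P. partition_on X P \<and> card P = k \<and> (\<forall>B\<in>P. card B = m \<and> f B)}"

lemma finite_block_partitions: "finite X \<Longrightarrow> finite (block_partitions m f k X)"
  unfolding block_partitions_def
  by (rule finite_subset[OF _ finitely_many_partition_on[of X]]) auto

lemma insert_block_partition:
  assumes "finite X" "A \<subseteq> X" "A \<noteq> {}" "card A = m" "f A" "Q \<in> block_partitions m f k (X - A)"
  shows "insert A Q \<in> block_partitions m f (Suc k) X"
proof -
  have Q: "partition_on (X - A) Q" "card Q = k" "\<forall>B\<in>Q. card B = m \<and> f B"
    using assms(6) by (auto simp: block_partitions_def)
  have un: "\<Union>Q = X - A" using partition_onD1[OF Q(1)] by simp
  then have "A \<notin> Q" using assms(3) by blast
  moreover have "finite Q" using Q(1) assms(1) finite_elements by blast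
  moreover have "partition_on X (insert A Q)"
    using partition_on_insert[of A Q X] un Q(1) assms(2,3) by (auto simp: disjnt_def)
  ultimately show ?thesis using Q assms by (simp add: block_partitions_def)
qed

lemma remove_block_partition:
  assumes "finite X" "P \<in> block_partitions m f (Suc k) X" "A \<in> P"
  shows "P - {A} \<in> block_partitions m f k (X - A)"
proof -
  have P: "partition_on X P" "card P = Suc k" "\<forall>B\<in>P. card B = m \<and> f B"
    using assms(2) by (auto simp: block_partitions_def)
  have "disjnt A (\<Union>(P - {A}))"
    using partition_onD2[OF P(1)] assms(3) by (auto simp: disjoint_def disjnt_def)
  then have "partition_on (X - A) (P - {A})"
    using partition_on_insert[of A "P - {A}" X] P(1) assms(3) by (simp add: insert_absorb)
  then show ?thesis
    using P assms(3) by (simp add: block_partitions_def)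
qed

text \<open>Partitions are sorted by their unique block containing \<open>x\<close>.\<close>

lemma card_block_partitions_Suc:
  assumes fin: "finite X" and x: "x \<in> X"
  shows "card (block_partitions m f (Suc k) X) =
         (\<Sum>A\<in>blocks_at m f x X. card (block_partitions m f k (X - A)))"
proof -
  let ?S = "SIGMA A:blocks_at m f x X. block_partitions m f k (X - A)"
  have notin: "x \<notin> B" if "(A, Q) \<in> ?S" "B \<in> Q" for A Q B
    using that by (auto simp: blocks_at_def block_partitions_def partition_on_def)
  have "bij_betw (\<lambda>(A, Q). insert A Q) ?S (block_partitions m f (Suc k) X)"
    unfolding bij_betw_def
  proof (intro conjI set_eqI iffI)
    show "inj_on (\<lambda>(A, Q). insert A Q) ?S"
    proof (rule inj_onI, clarify)
      fix A Q A' Q'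
      assume S: "A \<in> blocks_at m f x X" "Q \<in> block_partitions m f k (X - A)"
          "A' \<in> blocks_at m f x X" "Q' \<in> block_partitions m f k (X - A')"
        and eq: "insert A Q = insert A' Q'"
      have x: "x \<in> A" "x \<in> A'" using S(1,3) by (simp_all add: blocks_at_def)
      have "(A, Q) \<in> ?S" "(A', Q') \<in> ?S" using S by blast+
      then have "A \<notin> Q" "A' \<notin> Q" "A \<notin> Q'" "A' \<notin> Q'" using notin x by blast+
      with eq have "A = A'" by blast
      then show "A = A' \<and> Q = Q'"
        using eq insert_ident[OF \<open>A \<notin> Q\<close> \<open>A \<notin> Q'\<close>] by simp
    qed
  next
    fix P assume "P \<in> (\<lambda>(A, Q). insert A Q) ` ?S"
    then show "P \<in> block_partitions m f (Suc k) X"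
      using fin by (auto simp: blocks_at_def intro!: insert_block_partition)
  next
    fix P assume P: "P \<in> block_partitions m f (Suc k) X"
    then obtain A where A: "A \<in> P" "x \<in> A"
      using x by (auto simp: block_partitions_def partition_on_def)
    have "A \<in> blocks_at m f x X"
      using P A by (auto simp: blocks_at_def block_partitions_def partition_on_def)
    moreover have "P - {A} \<in> block_partitions m f k (X - A)"
      using remove_block_partition[OF fin P A(1)] .
    ultimately have "(A, P - {A}) \<in> ?S" by blast
    moreover have "P = (\<lambda>(A, Q). insert A Q) (A, P - {A})" using A by auto
    ultimately show "P \<in> (\<lambda>(A, Q). insert A Q) ` ?S" by (rule rev_image_eqI)
  qed
  then have "card (block_partitions m f (Suc k) X) = card ?S"
    by (simp add: bij_betw_same_card)
  also have "\<dots> = (\<Sum>A\<in>blocks_at m f x X. card (block_partitions m f k (X - A)))"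
    using fin by (intro card_SigmaI) (auto intro: finite_blocks_at finite_block_partitions)
  finally show ?thesis .
qed

lemma block_partitions_one:
  assumes "card Y = m" "m > 0"
  shows "block_partitions m f 1 Y = (if f Y then {{Y}} else {})"
proof -
  have "partition_on Y P \<and> card P = 1 \<longleftrightarrow> P = {Y}" for P
  proof
    assume P: "partition_on Y P \<and> card P = 1"
    then obtain B where "P = {B}" using card_1_singletonE by blast
    then show "P = {Y}" using P partition_onD1[of Y P] by simp
  next
    assume "P = {Y}"
    then show "partition_on Y P \<and> card P = 1"
      using assms partition_on_space[of Y] by fastforce
  qed
  then have "block_partitions m f 1 Y = {P. P = {Y} \<and> (\<forall>B\<in>P. card B = m \<and> f B)}"
    unfolding block_partitions_def by blast
  then show ?thesis using assms(1) by auto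
qed

text \<open>
  Two blocks are the base case. One block would not do: its count is 0 or 1. In the induction step,
  each term of the sum over the block at a fixed point is even.
\<close>

lemma even_card_block_partitions:
  assumes "k \<ge> 2" "m \<ge> 2" "mod2_cocycle m f X" "card X = k * m"
  shows "even (card (block_partitions m f k X))"
  using assms(1,3,4)
proof (induction k arbitrary: X rule: dec_induct)
  case base
  have fin: "finite X" and "X \<noteq> {}"
    using base assms(2) by (auto intro!: card_ge_0_finite)
  then obtain x where x: "x \<in> X" by blast
  have "card (block_partitions m f 2 X) =
      (\<Sum>A\<in>blocks_at m f x X. card (block_partitions m f 1 (X - A)))"
    using card_block_partitions_Suc[OF fin x, of m f 1] by (simp add: numeral_2_eq_2)
  also have "\<dots> = (\<Sum>A\<in>blocks_at m f x X. if f (X - A) then 1 else 0)"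
  proof (intro sum.cong refl)
    fix A assume "A \<in> blocks_at m f x X"
    then have "card (X - A) = m"
      using fin base finite_subset[of A X] by (auto simp: blocks_at_def card_Diff_subset)
    then show "card (block_partitions m f 1 (X - A)) = (if f (X - A) then 1 else 0)"
      using assms(2) block_partitions_one[of "X - A" m f] by simp
  qed
  also have "\<dots> = card {A\<in>blocks_at m f x X. f (X - A)}"
    using finite_blocks_at[OF fin] by (simp add: sum.If_cases Int_def)
  finally show ?case
    using even_card_complementary_blocks[OF base(1,2) assms(2) x] by simp
next
  case (step k)
  have fin: "finite X" and "X \<noteq> {}"
    using step.prems(2) assms(2) by (auto intro!: card_ge_0_finite)
  then obtain x where x: "x \<in> X" by blast
  have "even (card (block_partitions m f k (X - A)))" if "A \<in> blocks_at m f x X" for A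
  proof (rule step.IH)
    show "mod2_cocycle m f (X - A)"
      using step.prems(1) mod2_cocycle_subset by blast
    show "card (X - A) = k * m"
      using that fin step.prems(2) finite_subset[of A X]
      by (auto simp: blocks_at_def card_Diff_subset)
  qed
  then show ?case
    unfolding card_block_partitions_Suc[OF fin x] by (intro dvd_sum) auto
qed

text \<open>
  \<open>F\<close> is one of an even number of blocks at \<open>x\<close> whose complement in \<open>F \<union> G\<close> satisfies \<open>f\<close>, so there
  is another one.
\<close>

lemma exchange_blocks:
  assumes cocycle: "mod2_cocycle m f (F \<union> G)" and m: "m \<ge> 2"
    and F: "card F = m" "f F" "x \<in> F" and G: "card G = m" "f G" and disj: "F \<inter> G = {}"
  obtains A where "A \<in> blocks_at m f x (F \<union> G)" "A \<noteq> F" "f (F \<union> G - A)"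
proof -
  have fin: "finite F" "finite G" using F G m by (auto intro!: card_ge_0_finite)
  let ?E = "{A \<in> blocks_at m f x (F \<union> G). f (F \<union> G - A)}"
  have "card (F \<union> G) = 2 * m" using F G fin disj by (simp add: card_Un_disjoint)
  then have "even (card ?E)"
    using even_card_complementary_blocks[OF cocycle _ m, of x] F(3) by blast
  then have "?E \<noteq> {F}" by fastforce
  moreover have "F \<union> G - F = G" using disj by blast
  then have "F \<in> ?E" using F G(2) by (auto simp: blocks_at_def)
  ultimately obtain A where "A \<in> ?E" "A \<noteq> F" by blast
  then show thesis using that by blast
qed

text \<open>
  The block \<open>F\<close> of \<open>x\<close> in \<open>P\<close> counts once, and each other block \<open>G\<close> contributes the result \<open>a G\<close>
  of an exchange inside \<open>F \<union> G\<close>, which extends by the untouched blocks of \<open>P\<close>. Different \<open>G\<close> give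
  different \<open>a G\<close>, because \<open>a G\<close> has the size of \<open>F\<close> without being \<open>F\<close> and therefore meets \<open>G\<close>.
\<close>

lemma card_extendable_blocks_at_ge:
  assumes fin: "finite X" and m: "m \<ge> 2" and cocycle: "mod2_cocycle m f X"
    and P: "P \<in> block_partitions m f (Suc k) X" and x: "x \<in> X"
  shows "card {A \<in> blocks_at m f x X. block_partitions m f k (X - A) \<noteq> {}} \<ge> Suc k"
    (is "card ?E \<ge> _")
proof -
  have part: "partition_on X P" "card P = Suc k" "\<And>B. B \<in> P \<Longrightarrow> card B = m \<and> f B"
    using P by (auto simp: block_partitions_def)
  have finP: "finite P" using part(2) by (intro card_ge_0_finite) simp
  have sub: "B \<subseteq> X" if "B \<in> P" for B using partition_onD1[OF part(1)] that by blast
  have disj: "B \<inter> C = {}" if "B \<in> P" "C \<in> P" "B \<noteq> C" for B C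
    using partition_onD2[OF part(1)] that by (auto simp: disjoint_def)
  obtain F where F: "F \<in> P" "x \<in> F"
    using x partition_onD1[OF part(1)] by blast
  have "\<exists>A. A \<in> blocks_at m f x (F \<union> G) \<and> A \<noteq> F \<and> f (F \<union> G - A)" if G: "G \<in> P - {F}" for G
  proof -
    have "mod2_cocycle m f (F \<union> G)"
      using mod2_cocycle_subset[OF cocycle] sub F(1) G by blast
    then show ?thesis
      using exchange_blocks[of m f F G x] m part(3) F G disj[of F G] by blast
  qed
  then obtain a where a: "\<And>G. G \<in> P - {F} \<Longrightarrow>
      a G \<in> blocks_at m f x (F \<union> G) \<and> a G \<noteq> F \<and> f (F \<union> G - a G)"
    by metis
  have finF: "finite B" if "B \<in> P" for B using sub[OF that] fin finite_subset by blast
  have meets: "a G \<inter> G \<noteq> {}" if "G \<in> P - {F}" for G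
  proof
    assume "a G \<inter> G = {}"
    then have "a G \<subseteq> F" "card (a G) = card F"
      using a[OF that] part(3) F(1) by (auto simp: blocks_at_def)
    then have "a G = F" using finF[OF F(1)] by (simp add: card_subset_eq)
    then show False using a[OF that] by blast
  qed
  have "inj_on a (P - {F})"
  proof (rule inj_onI, rule ccontr)
    fix G H assume GH: "G \<in> P - {F}" "H \<in> P - {F}" "a G = a H" "G \<noteq> H"
    then have "a G \<inter> G \<subseteq> (F \<union> H) \<inter> G" using a[OF GH(2)] by (auto simp: blocks_at_def)
    also have "\<dots> = {}" using disj[of F G] disj[of H G] GH F(1) by blast
    finally show False using meets[OF GH(1)] by blast
  qed
  moreover have "F \<notin> a ` (P - {F})" using a by blast
  ultimately have card: "card (insert F (a ` (P - {F}))) = Suc k"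
    using finP F(1) part(2) by (simp add: card_image)
  have "F \<in> ?E"
    using remove_block_partition[OF fin P F(1)] F part(3) sub by (auto simp: blocks_at_def)
  moreover have "a G \<in> ?E" if G: "G \<in> P - {F}" for G
  proof -
    have aG: "a G \<subseteq> F \<union> G" "x \<in> a G" "card (a G) = m" "f (a G)" "f (F \<union> G - a G)"
      using a[OF G] by (auto simp: blocks_at_def)
    have "k > 0"
    proof (rule ccontr)
      assume "\<not> k > 0"
      then have "P = {F}" using part(2) F(1) by (auto simp: card_1_singleton_iff)
      then show False using G by blast
    qed
    then obtain j where j: "k = Suc j" using gr0_implies_Suc by blast
    have "P - {F} - {G} \<in> block_partitions m f j (X - F - G)"
      using remove_block_partition[OF finite_Diff[OF fin], of "P - {F}" m f j F G]
        remove_block_partition[OF fin P F(1)] G unfolding j by blast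
    moreover have "X - a G - (F \<union> G - a G) = X - F - G" using aG(1) by blast
    moreover have C: "card (F \<union> G - a G) = m"
    proof -
      have FG: "finite F" "finite G" "card F = m" "card G = m" "F \<inter> G = {}"
        using finF part(3) F(1) G disj[of F G] by blast+
      then have "card (F \<union> G) = 2 * m" by (simp add: card_Un_disjoint)
      moreover have "finite (a G)" using aG(1) FG(1,2) finite_subset by blast
      ultimately show ?thesis using aG(1,3) by (simp add: card_Diff_subset)
    qed
    moreover have "F \<union> G - a G \<noteq> {}" using C m by force
    moreover have "F \<union> G - a G \<subseteq> X - a G" using sub F(1) G by blast
    ultimately have "insert (F \<union> G - a G) (P - {F} - {G}) \<in> block_partitions m f k (X - a G)"
      unfolding j using fin aG(5)
      by (intro insert_block_partition) simp_all
    moreover have "a G \<subseteq> X" using aG(1) sub F(1) G by blast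
    ultimately show ?thesis using aG by (auto simp: blocks_at_def)
  qed
  ultimately have "insert F (a ` (P - {F})) \<subseteq> ?E" by blast
  moreover have "finite ?E" using finite_blocks_at[OF fin] by simp
  ultimately show ?thesis using card_mono[of ?E "insert F (a ` (P - {F}))"] card by simp
qed

text \<open>
  There are at least \<open>Suc k\<close> choices for the block at a point, and by induction each of them leaves
  at least \<open>fact k\<close> ways to partition the rest.
\<close>

lemma card_block_partitions_ge_fact:
  assumes m: "m \<ge> 2" and "finite X" "mod2_cocycle m f X" "block_partitions m f k X \<noteq> {}"
  shows "card (block_partitions m f k X) \<ge> fact k"
  using assms(2-)
proof (induction k arbitrary: X)
  case 0
  then have "card (block_partitions m f 0 X) > 0"
    using finite_block_partitions[of X m f 0] by (simp add: card_gt_0_iff)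
  then show ?case by simp
next
  case (Suc k)
  then obtain P where P: "P \<in> block_partitions m f (Suc k) X" by blast
  then have "P \<noteq> {}" "\<Union>P = X" "\<forall>B\<in>P. B \<noteq> {}"
    by (auto simp: block_partitions_def partition_on_def)
  then obtain x where x: "x \<in> X" by blast
  let ?E = "{A \<in> blocks_at m f x X. block_partitions m f k (X - A) \<noteq> {}}"
  have "fact (Suc k) \<le> card ?E * (fact k :: nat)"
    using card_extendable_blocks_at_ge[OF Suc.prems(1) m Suc.prems(2) P x]
    by (simp only: fact_Suc of_nat_id mult_le_mono1)
  also have "\<dots> = (\<Sum>A\<in>?E. fact k)" by simp
  also have "\<dots> \<le> (\<Sum>A\<in>?E. card (block_partitions m f k (X - A)))"
    using Suc.prems mod2_cocycle_subset[OF Suc.prems(2)] by (intro sum_mono Suc.IH) auto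
  also have "\<dots> \<le> (\<Sum>A\<in>blocks_at m f x X. card (block_partitions m f k (X - A)))"
    using finite_blocks_at[OF Suc.prems(1)] by (intro sum_mono2) auto
  also have "\<dots> = card (block_partitions m f (Suc k) X)"
    using card_block_partitions_Suc[OF Suc.prems(1) x] by simp
  finally show ?case .
qed

section \<open>Birch partitions\<close>

theorem theorem2:
  fixes X :: "(real ^ 'n) set" and k :: nat
  assumes "k \<ge> 2"
    and "card X = k * (CARD('n) + 1)"
    and "general_position_wrt X 0"
  shows "even (birch_count k X) \<and>
         (birch_count k X > 0 \<longrightarrow> birch_count k X \<ge> fact k)"
proof -
  let ?m = "DIM(real ^ 'n) + 1" and ?f = "\<lambda>B::(real ^ 'n) set. 0 \<in> convex hull B"
  have count: "birch_count k X = card (block_partitions ?m ?f k X)"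
    by (simp add: birch_count_def birch_partition_def block_partitions_def)
  have cocycle: "mod2_cocycle ?m ?f X"
    using mod2_cocycle_zero_in_convex_hull[OF assms(3)] .
  have m: "?m \<ge> 2" using DIM_positive[where 'a = "real ^ 'n"] by linarith
  have card: "card X = k * ?m" using assms(2) by simp
  then have fin: "finite X" using assms(1) by (intro card_ge_0_finite) simp
  show ?thesis
    unfolding count
    using even_card_block_partitions[OF assms(1) m cocycle card]
      card_block_partitions_ge_fact[OF m fin cocycle, of k] by (auto simp: card_gt_0_iff)
qed

end
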